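(* The price of anarchy, with respect to liquid welfare, of coarse correlated equilibria of simultaneous first-price auctions with budget-constrained bidders having subadditive valuations is at most $3$. That is, for every such auction instance $I$ and every coarse correlated equilibrium $A$ of $I$, $\mathrm{OPT}(I)\le 3\,\mathrm{LW}(I,A)$.
   Context: Simultaneous first-price auction: bidders $N=[n]$, $n\ge2$; items $M=[m]$, $m\ge1$. Bidder $i$ submits $a_i=(a_{ij})_{j\in M}\in\mathcal A_i=\mathbb R_{\ge0}^m$; $\mathcal A=\prod_i\mathcal A_i$. Each item $j$ is awarded to exactly one bidder among those with the highest bid on $j$, ties being resolved by a fixed order over bidders; $X_i(a)\subseteq M$ is the set of items won by $i$, and $i$ pays $P_i(a)=\sum_{j\in X_i(a)}a_{ij}$. Bidder $i$ has a monotone valuation $v_i:2^M\to\mathbb R_{\ge0}$, $v_i(\emptyset)=0$, and a budget $B_i\in(0,\infty]$; $v_i$ is subadditive if $v_i(S\cup T)\le v_i(S)+v_i(T)$ for all $S,T\subseteq M$. Utility: $u_i(a)=v_i(X_i(a))-P_i(a)$. The feasible allocations $\mathcal X$ are the profiles $(x_i)_{i\in N}$ of pairwise disjoint subsets of $M$. $\Delta(S)$ denotes probability distributions on $S$. For $A\in\Delta(\mathcal A)$ let $A_{-i}$ be the marginal on the others' actions, and let $\mathcal C_i(A_{-i})$ be the set of $A_i'\in\Delta(\mathcal A_i)$ with $\mathbb E_{a_i'\sim A_i',a_{-i}\sim A_{-i}}[P_i(a_i',a_{-i})]\le B_i$ (independent draws). $A\in\Delta(\mathcal A)$ is a coarse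 correlated equilibrium if for all $i$: $\mathbb E_{a\sim A}[P_i(a)]\le B_i$, and $\mathbb E_{a\sim A}[u_i(a)]\ge\mathbb E_{a_i'\sim A_i',a_{-i}\sim A_{-i}}[u_i(a_i',a_{-i})]$ for all $A_i'\in\mathcal C_i(A_{-i})$. $\mathrm{LW}(I,A)=\sum_i\min\{\mathbb E_{a\sim A}[v_i(X_i(a))],B_i\}$ and $\mathrm{OPT}(I)=\max_{\chi\in\Delta(\mathcal X)}\sum_i\min\{\mathbb E_{x\sim\chi}[v_i(x_i)],B_i\}$. The price of anarchy is the supremum of $\mathrm{OPT}(I)/\mathrm{LW}(I,A)$ over instances $I$ and equilibria $A$. *)

theory Defs
  imports "HOL-Probability.Probability"
begin

record auction =
  num_bidders :: nat
  num_items :: nat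
  tie_order :: "nat rel"
  valuation :: "nat \<Rightarrow> nat set \<Rightarrow> real"
  budget :: "nat \<Rightarrow> ereal"

definition bidders :: "auction \<Rightarrow> nat set" where
  "bidders I = {..<num_bidders I}"

definition items :: "auction \<Rightarrow> nat set" where
  "items I = {..<num_items I}"

definition auction_instance :: "auction \<Rightarrow> bool" where
  "auction_instance I \<longleftrightarrow>
     2 \<le> num_bidders I \<and> 1 \<le> num_items I \<and>
     linear_order_on (bidders I) (tie_order I) \<and>
     (\<forall>i\<in>bidders I.
        valuation I i {} = 0 \<and>
        (\<forall>S\<subseteq>items I. 0 \<le> valuation I i S) \<and>
        (\<forall>S T. S \<subseteq> T \<and> T \<subseteq> items I \<longrightarrow> valuation I i S \<le> valuation I i T) \<and>
        0 < budget I i)"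

definition subadditive_valuations :: "auction \<Rightarrow> bool" where
  "subadditive_valuations I \<longleftrightarrow>
     (\<forall>i\<in>bidders I. \<forall>S\<subseteq>items I. \<forall>T\<subseteq>items I.
        valuation I i (S \<union> T) \<le> valuation I i S + valuation I i T)"

subsection \<open>Outcomes\<close>

text \<open>A bid profile \<open>a\<close> gives bidder \<open>i\<close>'s bid on item \<open>j\<close> as \<open>a i j\<close>. Among the highest
  bidders on an item, the one that comes first in the tie order wins it.\<close>

definition highest_bidders :: "auction \<Rightarrow> (nat \<Rightarrow> nat \<Rightarrow> real) \<Rightarrow> nat \<Rightarrow> nat set" where
  "highest_bidders I a j = {i \<in> bidders I. \<forall>k\<in>bidders I. a k j \<le> a i j}"

definition won_items :: "auction \<Rightarrow> nat \<Rightarrow> (nat \<Rightarrow> nat \<Rightarrow> real) \<Rightarrow> nat set" where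
  "won_items I i a =
     {j \<in> items I. i \<in> highest_bidders I a j \<and>
                   (\<forall>k\<in>highest_bidders I a j. (i, k) \<in> tie_order I)}"

definition payment :: "auction \<Rightarrow> nat \<Rightarrow> (nat \<Rightarrow> nat \<Rightarrow> real) \<Rightarrow> real" where
  "payment I i a = (\<Sum>j\<in>won_items I i a. a i j)"

definition utility :: "auction \<Rightarrow> nat \<Rightarrow> (nat \<Rightarrow> nat \<Rightarrow> real) \<Rightarrow> real" where
  "utility I i a = valuation I i (won_items I i a) - payment I i a"

subsection \<open>Randomized bids and equilibria\<close>

text \<open>Expectation as an extended real. The Bochner integral would assign 0 to a non-integrable
  function, whereas a bidder with infinite budget may have infinite expected payment, and then
  expected utility \<open>-\<infinity>\<close>. The case \<open>\<infinity> - \<infinity>\<close> does not arise below, since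
  payments are nonnegative and valuations are bounded.\<close>

definition expect :: "'a measure \<Rightarrow> ('a \<Rightarrow> real) \<Rightarrow> ereal" where
  "expect D f = enn2ereal (\<integral>\<^sup>+ x. ennreal (f x) \<partial>D) - enn2ereal (\<integral>\<^sup>+ x. ennreal (- f x) \<partial>D)"

definition action_space :: "auction \<Rightarrow> (nat \<Rightarrow> real) measure" where
  "action_space I = (\<Pi>\<^sub>M j\<in>items I. restrict_space borel {0..})"

definition profile_space :: "auction \<Rightarrow> nat set \<Rightarrow> (nat \<Rightarrow> nat \<Rightarrow> real) measure" where
  "profile_space I K = (\<Pi>\<^sub>M i\<in>K. action_space I)"

text \<open>The set of probability distributions on a measurable space \<open>S\<close> is
  \<open>space (prob_algebra S)\<close>.\<close>

definition others_marginal ::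
    "auction \<Rightarrow> nat \<Rightarrow> (nat \<Rightarrow> nat \<Rightarrow> real) measure \<Rightarrow> (nat \<Rightarrow> nat \<Rightarrow> real) measure" where
  "others_marginal I i A =
     distr A (profile_space I (bidders I - {i})) (\<lambda>a. restrict a (bidders I - {i}))"

text \<open>Expectation of \<open>f (b, c)\<close> where bidder \<open>i\<close>'s action \<open>b\<close> and the others' actions \<open>c\<close> are
  drawn independently from \<open>D\<close> and \<open>C\<close>.\<close>

definition deviation_expect ::
    "nat \<Rightarrow> (nat \<Rightarrow> real) measure \<Rightarrow> (nat \<Rightarrow> nat \<Rightarrow> real) measure \<Rightarrow>
     ((nat \<Rightarrow> nat \<Rightarrow> real) \<Rightarrow> real) \<Rightarrow> ereal" where
  "deviation_expect i D C f = expect (D \<Otimes>\<^sub>M C) (\<lambda>(b, c). f (c(i := b)))"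

definition feasible_deviations ::
    "auction \<Rightarrow> nat \<Rightarrow> (nat \<Rightarrow> nat \<Rightarrow> real) measure \<Rightarrow> (nat \<Rightarrow> real) measure set" where
  "feasible_deviations I i C =
     {D \<in> space (prob_algebra (action_space I)).
        deviation_expect i D C (payment I i) \<le> budget I i}"

definition coarse_correlated_eq :: "auction \<Rightarrow> (nat \<Rightarrow> nat \<Rightarrow> real) measure \<Rightarrow> bool" where
  "coarse_correlated_eq I A \<longleftrightarrow>
     A \<in> space (prob_algebra (profile_space I (bidders I))) \<and>
     (\<forall>i\<in>bidders I.
        expect A (payment I i) \<le> budget I i \<and>
        (\<forall>D\<in>feasible_deviations I i (others_marginal I i A).
           deviation_expect i D (others_marginal I i A) (utility I i) \<le> expect A (utility I i)))"

subsection \<open>Liquid welfare and price of anarchy\<close>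

definition liquid_welfare :: "auction \<Rightarrow> (nat \<Rightarrow> nat \<Rightarrow> real) measure \<Rightarrow> ereal" where
  "liquid_welfare I A =
     (\<Sum>i\<in>bidders I. min (expect A (\<lambda>a. valuation I i (won_items I i a))) (budget I i))"

definition allocations :: "auction \<Rightarrow> (nat \<Rightarrow> nat set) set" where
  "allocations I = {x \<in> bidders I \<rightarrow>\<^sub>E Pow (items I). disjoint_family_on x (bidders I)}"

text \<open>There are finitely many allocations, so the distributions over them are exactly the \<open>pmf\<close>s
  supported on them, and the supremum below is a maximum by compactness.\<close>

definition opt_welfare :: "auction \<Rightarrow> ereal" where
  "opt_welfare I =
     (SUP p\<in>{p. set_pmf p \<subseteq> allocations I}.
        (\<Sum>i\<in>bidders I. min (expect (measure_pmf p) (\<lambda>x. valuation I i (x i))) (budget I i)))"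

text \<open>In \<^typ>\<open>ereal\<close>, \<open>0 / 0 = 0\<close> and \<open>x / 0 = \<infinity>\<close> for \<open>x > 0\<close>.\<close>

definition price_of_anarchy :: "auction set \<Rightarrow> ereal" where
  "price_of_anarchy \<I> =
     (SUP (I, A)\<in>{(I, A). I \<in> \<I> \<and> coarse_correlated_eq I A}. opt_welfare I / liquid_welfare I A)"

end

theory Submission
  imports Defs
begin

text \<open>Bidder \<open>i\<close> deviates as follows: draw a set \<open>S\<close> of items and an independent copy \<open>a\<close> of the equilibrium
  bids, and bid slightly more than the highest rival bid in \<open>a\<close> on each item of \<open>S\<close>, and 0 elsewhere. As
  the copy and the actual bids are exchangeable, subadditivity yields half of the value of \<open>S\<close>, at an
  expected payment of about \<open>Q\<^sub>i\<close>, the expected highest rival bids on \<open>S\<close>. The set \<open>S\<close> is \<open>i\<close>'s part of the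
  optimal allocation with probability \<open>o\<^sub>i / V\<^sub>i\<close> and empty otherwise, where \<open>V\<^sub>i\<close> is \<open>i\<close>'s expected value in
  the optimum and \<open>o\<^sub>i = min {V\<^sub>i, B\<^sub>i}\<close>. If this violates the budget then \<open>o\<^sub>i \<le> Q\<^sub>i\<close>, so in any case the
  equilibrium utility is at least \<open>o\<^sub>i / 2 - Q\<^sub>i\<close>.

  Let \<open>l\<^sub>i\<close> be \<open>i\<close>'s equilibrium liquid welfare and \<open>P\<^sub>i \<le> l\<^sub>i\<close> the expected payment. If \<open>l\<^sub>i\<close> is the expected value,
  then \<open>l\<^sub>i - P\<^sub>i \<ge> o\<^sub>i / 2 - Q\<^sub>i\<close>; if \<open>l\<^sub>i = B\<^sub>i\<close>, then \<open>o\<^sub>i \<le> l\<^sub>i\<close>. Either way \<open>o\<^sub>i \<le> 3 l\<^sub>i - 2 P\<^sub>i + 2 Q\<^sub>i\<close>, and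
  the claim follows by summation, as \<open>\<Sum> Q\<^sub>i\<close> is at most the revenue \<open>\<Sum> P\<^sub>i\<close>.\<close>

section \<open>Expectations, measurability and finite orders\<close>

lemma expect_eq_integral:
  assumes "integrable D f"
  shows "expect D f = ereal (integral\<^sup>L D f)"
proof -
  have fin: "(\<integral>\<^sup>+ x. ennreal (f x) \<partial>D) \<noteq> \<infinity>" "(\<integral>\<^sup>+ x. ennreal (- f x) \<partial>D) \<noteq> \<infinity>"
    using assms by (auto simp: real_integrable_def)
  have "enn2ereal X - enn2ereal Y = ereal (enn2real X - enn2real Y)" if "X \<noteq> \<infinity>" "Y \<noteq> \<infinity>" for X Y
    using that by (cases X; cases Y) auto
  then show ?thesis
    using fin by (simp add: expect_def real_lebesgue_integral_def[OF assms])
qed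

lemma expect_cong: "(\<And>x. x \<in> space D \<Longrightarrow> f x = g x) \<Longrightarrow> expect D f = expect D g"
  unfolding expect_def by (intro arg_cong2[of _ _ _ _ "(-)"] arg_cong[of _ _ enn2ereal] nn_integral_cong) auto

lemma expect_nonneg: "(\<And>x. x \<in> space D \<Longrightarrow> 0 \<le> f x) \<Longrightarrow> 0 \<le> expect D f"
proof -
  assume *: "\<And>x. x \<in> space D \<Longrightarrow> 0 \<le> f x"
  then have "(\<integral>\<^sup>+ x. ennreal (- f x) \<partial>D) = (\<integral>\<^sup>+ x. 0 \<partial>D)"
    by (intro nn_integral_cong) (auto simp: ennreal_neg)
  then show ?thesis by (simp add: expect_def zero_ennreal.rep_eq)
qed

lemma expect_distr:
  assumes [measurable]: "g \<in> measurable D E" "f \<in> borel_measurable E"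
  shows "expect (distr D E g) f = expect D (\<lambda>x. f (g x))"
  by (simp add: expect_def nn_integral_distr)

text \<open>The upper bound makes the positive part integrable. An infinite negative part would then
  force the expectation to be -\<infinity>, against its sign.\<close>

lemma (in finite_measure) integrable_of_expect_nonneg:
  assumes [measurable]: "f \<in> borel_measurable M"
    and bound: "\<And>x. x \<in> space M \<Longrightarrow> f x \<le> C" and "0 \<le> expect M f"
  shows "integrable M f"
proof -
  have "(\<integral>\<^sup>+ x. ennreal (f x) \<partial>M) \<le> (\<integral>\<^sup>+ x. ennreal C \<partial>M)"
    using bound by (intro nn_integral_mono) (auto intro: ennreal_leI)
  also have "\<dots> < \<infinity>"
    by (simp add: ennreal_mult_less_top emeasure_eq_measure)
  finally have pos: "(\<integral>\<^sup>+ x. ennreal (f x) \<partial>M) < \<infinity>" .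
  then have "(\<integral>\<^sup>+ x. ennreal (- f x) \<partial>M) \<noteq> \<infinity>"
    using assms(3) unfolding expect_def by (cases "\<integral>\<^sup>+ x. ennreal (f x) \<partial>M") auto
  with pos show ?thesis by (simp add: real_integrable_def)
qed

text \<open>Only finitely many subsets of \<open>J\<close> can occur as values, and each fibre of
  \<open>W\<close> is a finite intersection of membership events and their complements. Hence
  \<open>W\<close> is measurable into a discrete space, from which \<open>h\<close> is
  measurable.\<close>

lemma borel_measurable_set_valued:
  fixes h :: "'b set \<Rightarrow> real"
  assumes "finite J" and sub: "\<And>x. x \<in> space D \<Longrightarrow> W x \<subseteq> J"
    and meas: "\<And>j. j \<in> J \<Longrightarrow> Measurable.pred D (\<lambda>x. j \<in> W x)"
  shows "(\<lambda>x. h (W x)) \<in> borel_measurable D"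
proof -
  have "W \<in> measurable D (count_space (Pow J))"
  proof (subst measurable_count_space_eq2)
    show "finite (Pow J)" using \<open>finite J\<close> by simp
    have "W -` {T} \<inter> space D \<in> sets D" if "T \<in> Pow J" for T
    proof -
      have "W -` {T} \<inter> space D = {x \<in> space D. \<forall>j\<in>J. j \<in> W x \<longleftrightarrow> j \<in> T}"
        using sub that by (fastforce simp: set_eq_iff)
      also have "\<dots> \<in> sets D"
      proof (rule sets.sets_Collect_finite_All[OF _ \<open>finite J\<close>])
        fix j assume "j \<in> J"
        note [measurable] = meas[OF this]
        show "{x \<in> space D. j \<in> W x \<longleftrightarrow> j \<in> T} \<in> sets D"
          by (cases "j \<in> T") auto
      qed
      finally show ?thesis .
    qed
    then show "W \<in> space D \<rightarrow> Pow J \<and> (\<forall>T\<in>Pow J. W -` {T} \<inter> space D \<in> sets D)"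
      using sub by auto
  qed
  then show ?thesis
    by (rule measurable_compose) simp
qed

lemma finite_linear_order_least:
  assumes "linear_order_on A r" "finite H" "H \<noteq> {}" "H \<subseteq> A"
  shows "\<exists>k\<in>H. \<forall>l\<in>H. (k, l) \<in> r"
  using assms(2-)
proof (induction H rule: finite_ne_induct)
  case (singleton x)
  then show ?case
    using assms(1) by (auto simp: order_on_defs refl_on_def)
next
  case (insert x F)
  then obtain k where k: "k \<in> F" "\<forall>l\<in>F. (k, l) \<in> r" by auto
  have r: "trans r" "refl_on A r" "total_on A r"
    using assms(1) by (auto simp: order_on_defs)
  have "(x, k) \<in> r \<or> (k, x) \<in> r"
    using r k insert by (auto simp: total_on_def)
  moreover have "(x, x) \<in> r"
    using r insert by (auto simp: refl_on_def)
  ultimately show ?case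
    using k r by (auto dest: transD)
qed

lemma integrable_pair_fst:
  fixes f :: "'a \<Rightarrow> real"
  assumes "prob_space D" "prob_space E" and int: "integrable D f"
  shows "integrable (D \<Otimes>\<^sub>M E) (\<lambda>(x, y). f x)"
    and "(\<integral>(x, y). f x \<partial>(D \<Otimes>\<^sub>M E)) = (\<integral>x. f x \<partial>D)"
proof -
  interpret D: prob_space D by fact
  interpret E: prob_space E by fact
  interpret DE: pair_prob_space D E ..
  have [measurable]: "f \<in> borel_measurable D" using int by auto
  show *: "integrable (D \<Otimes>\<^sub>M E) (\<lambda>(x, y). f x)"
    using int by (intro DE.Fubini_integrable) (auto simp: E.prob_space)
  show "(\<integral>(x, y). f x \<partial>(D \<Otimes>\<^sub>M E)) = (\<integral>x. f x \<partial>D)"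
    using DE.integral_fst'[OF *] by (simp add: E.prob_space)
qed

subsection \<open>Bids, payments and the deviation\<close>

text \<open>The threshold that \<open>i\<close> has to beat on item \<open>j\<close>. The maximum is
  over a nonempty set because there are at least two bidders
  (\<open>rivals_nonempty\<close>).\<close>

definition rival_bid :: "auction \<Rightarrow> nat \<Rightarrow> (nat \<Rightarrow> nat \<Rightarrow> real) \<Rightarrow> nat \<Rightarrow> real" where
  "rival_bid I i a j = Max ((\<lambda>k. a k j) ` (bidders I - {i}))"

locale subadditive_auction =
  fixes I :: auction
  assumes inst: "auction_instance I" and subadd: "subadditive_valuations I"
begin

abbreviation "N \<equiv> bidders I"
abbreviation "J \<equiv> items I"
abbreviation "v \<equiv> valuation I"
abbreviation "Prof \<equiv> profile_space I N"

lemma finite_bidders [simp, intro]: "finite N" and finite_items [simp, intro]: "finite J"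
  by (auto simp: bidders_def items_def)

lemma rivals_nonempty: "N - {i} \<noteq> {}"
proof -
  have "card {..<2::nat} \<le> card N"
    using inst by (simp add: auction_instance_def bidders_def)
  then have "\<not> N \<subseteq> {i}"
    using card_mono[of "{i}" N] by auto
  then show ?thesis by blast
qed

lemma valuation_empty: "i \<in> N \<Longrightarrow> v i {} = 0"
  and valuation_nonneg: "i \<in> N \<Longrightarrow> S \<subseteq> J \<Longrightarrow> 0 \<le> v i S"
  and valuation_mono: "i \<in> N \<Longrightarrow> S \<subseteq> T \<Longrightarrow> T \<subseteq> J \<Longrightarrow> v i S \<le> v i T"
  and budget_pos: "i \<in> N \<Longrightarrow> 0 < budget I i"
  using inst by (auto simp: auction_instance_def)

lemma valuation_subadd: "i \<in> N \<Longrightarrow> S \<subseteq> J \<Longrightarrow> T \<subseteq> J \<Longrightarrow> v i (S \<union> T) \<le> v i S + v i T"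
  using subadd by (auto simp: subadditive_valuations_def)

lemma space_action: "space (action_space I) = J \<rightarrow>\<^sub>E {0..}"
  by (simp add: action_space_def space_PiM)

lemma space_profile: "space (profile_space I K) = K \<rightarrow>\<^sub>E (J \<rightarrow>\<^sub>E {0..})"
  by (simp add: profile_space_def space_PiM space_action)

lemma bid_nonneg: "a \<in> space Prof \<Longrightarrow> k \<in> N \<Longrightarrow> j \<in> J \<Longrightarrow> 0 \<le> a k j"
  unfolding space_profile by (auto simp: PiE_iff)

lemma measurable_bid [measurable]:
  assumes "k \<in> N" "j \<in> J"
  shows "(\<lambda>a. a k j) \<in> borel_measurable Prof"
proof -
  have "(\<lambda>a. a k j) \<in> measurable Prof (restrict_space borel {0..})"
    unfolding profile_space_def action_space_def
    using assms by (intro measurable_compose[OF measurable_component_singleton[of k] measurable_component_singleton[of j]])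
  then show ?thesis
    by (simp add: measurable_restrict_space2_iff)
qed

lemma measurable_won:
  assumes "j \<in> J"
  shows "Measurable.pred Prof (\<lambda>a. j \<in> won_items I i a)"
proof (cases "i \<in> N")
  case True
  have le: "Measurable.pred Prof (\<lambda>a. a k j \<le> a l j)" if "k \<in> N" "l \<in> N" for k l
    unfolding pred_def using that assms by (intro borel_measurable_le measurable_bid)
  have "(\<lambda>a. j \<in> won_items I i a) = (\<lambda>a. (\<forall>k\<in>N. a k j \<le> a i j) \<and>
      (\<forall>k\<in>N. (\<forall>l\<in>N. a l j \<le> a k j) \<longrightarrow> (i, k) \<in> tie_order I))"
    using True assms by (auto simp: won_items_def highest_bidders_def fun_eq_iff)
  also have "Measurable.pred Prof \<dots>"
    using True by (intro pred_intros_logic pred_intros_finite finite_bidders le measurable_const)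
      simp_all
  finally show ?thesis .
qed (simp add: won_items_def highest_bidders_def)

lemma won_items_subset: "won_items I i a \<subseteq> J"
  by (auto simp: won_items_def)

lemma measurable_value: "(\<lambda>a. v i (won_items I i a)) \<in> borel_measurable Prof"
  by (intro borel_measurable_set_valued[where J=J] measurable_won won_items_subset finite_items)

text \<open>The index set no longer depends on the bids, which reduces measurability to single items
  and allows sums over items and bidders to be swapped.\<close>

lemma payment_eq: "payment I i a = (\<Sum>j\<in>J. if j \<in> won_items I i a then a i j else 0)"
  unfolding payment_def using won_items_subset[of i a]
  by (simp add: sum.If_cases Int_absorb1)

lemma measurable_payment:
  assumes "i \<in> N"
  shows "payment I i \<in> borel_measurable Prof"
proof -
  have "(\<lambda>a. if j \<in> won_items I i a then a i j else 0) \<in> borel_measurable Prof" if "j \<in> J" for j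
    using assms that predE[OF measurable_won[OF that, of i]]
    by (intro measurable_If measurable_bid borel_measurable_const)
  then show ?thesis unfolding payment_eq by (rule borel_measurable_sum)
qed

lemma measurable_utility:
  assumes "i \<in> N"
  shows "utility I i \<in> borel_measurable Prof"
  unfolding utility_def by (intro borel_measurable_diff measurable_value measurable_payment assms)

lemma payment_nonneg: "a \<in> space Prof \<Longrightarrow> i \<in> N \<Longrightarrow> 0 \<le> payment I i a"
  unfolding payment_def using won_items_subset by (auto intro!: sum_nonneg bid_nonneg)

lemma value_bounds:
  assumes "i \<in> N"
  shows "0 \<le> v i (won_items I i a)" "v i (won_items I i a) \<le> v i J"
  using assms won_items_subset by (auto intro: valuation_nonneg valuation_mono)

section \<open>Highest bids, winners and revenue\<close>

lemma measurable_rival_bid [measurable]: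
  assumes "j \<in> J"
  shows "(\<lambda>a. rival_bid I i a j) \<in> borel_measurable Prof"
  unfolding rival_bid_def using assms by (intro borel_measurable_Max) auto

lemma rival_bid_nonneg:
  assumes "a \<in> space Prof" "j \<in> J"
  shows "0 \<le> rival_bid I i a j"
proof -
  obtain k where "k \<in> N - {i}" using rivals_nonempty by blast
  then show ?thesis
    unfolding rival_bid_def using bid_nonneg[OF assms(1) _ assms(2), of k]
    by (intro order_trans[OF _ Max_ge]) auto
qed

lemma rival_bid_le_iff: "rival_bid I i a j \<le> x \<longleftrightarrow> (\<forall>k\<in>N - {i}. a k j \<le> x)"
  unfolding rival_bid_def using rivals_nonempty[of i] by (subst Max_le_iff) auto

lemma rival_bid_less_iff: "rival_bid I i a j < x \<longleftrightarrow> (\<forall>k\<in>N - {i}. a k j < x)"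
  unfolding rival_bid_def using rivals_nonempty[of i] by (subst Max_less_iff) auto

text \<open>Some bidder attains the maximal bid, and the tie order has a least element on the finite
  set of bidders who do.\<close>

lemma winner_exists:
  assumes "j \<in> J"
  shows "\<exists>k\<in>N. j \<in> won_items I k a"
proof -
  have "N \<noteq> {}" using rivals_nonempty by blast
  then have "Max ((\<lambda>k. a k j) ` N) \<in> (\<lambda>k. a k j) ` N"
    by (intro Max_in) auto
  then obtain k where "k \<in> N" "a k j = Max ((\<lambda>k. a k j) ` N)" by auto
  then have "k \<in> highest_bidders I a j"
    by (auto simp: highest_bidders_def)
  then have "highest_bidders I a j \<noteq> {}" by blast
  then have "\<exists>k\<in>highest_bidders I a j. \<forall>l\<in>highest_bidders I a j. (k, l) \<in> tie_order I"
    using inst by (intro finite_linear_order_least[of N])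
      (auto simp: highest_bidders_def auction_instance_def)
  then show ?thesis
    using assms by (auto simp: won_items_def highest_bidders_def)
qed

text \<open>Every item is sold, and its winner pays the highest bid on it.\<close>

lemma highest_bids_le_revenue:
  assumes a: "a \<in> space Prof"
  shows "(\<Sum>j\<in>J. Max ((\<lambda>k. a k j) ` N)) \<le> (\<Sum>i\<in>N. payment I i a)"
proof -
  have "(\<Sum>j\<in>J. Max ((\<lambda>k. a k j) ` N)) \<le> (\<Sum>j\<in>J. \<Sum>i\<in>N. if j \<in> won_items I i a then a i j else 0)"
  proof (rule sum_mono)
    fix j assume j: "j \<in> J"
    obtain k where k: "k \<in> N" "j \<in> won_items I k a" using winner_exists[OF j] by blast
    then have "Max ((\<lambda>k. a k j) ` N) \<le> a k j"
      by (subst Max_le_iff) (auto simp: won_items_def highest_bidders_def)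
    also have "\<dots> = (\<Sum>i\<in>{k}. if j \<in> won_items I i a then a i j else 0)" using k by simp
    also have "\<dots> \<le> (\<Sum>i\<in>N. if j \<in> won_items I i a then a i j else 0)"
      using k j by (intro sum_mono2) (auto intro!: bid_nonneg[OF a])
    finally show "Max ((\<lambda>k. a k j) ` N) \<le> (\<Sum>i\<in>N. if j \<in> won_items I i a then a i j else 0)" .
  qed
  also have "\<dots> = (\<Sum>i\<in>N. payment I i a)"
    unfolding payment_eq by (rule sum.swap)
  finally show ?thesis .
qed

lemma rival_bid_le_highest: "rival_bid I i a j \<le> Max ((\<lambda>k. a k j) ` N)"
  unfolding rival_bid_le_iff by (auto intro!: Max_ge)

section \<open>The deviation that outbids a sampled profile\<close>

lemma measurable_deviation:
  assumes "\<beta> \<in> measurable D (action_space I)" "f \<in> measurable D Prof" "i \<in> N"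
  shows "(\<lambda>x. (f x)(i := \<beta> x)) \<in> measurable D Prof"
  using assms unfolding profile_space_def by (intro measurable_fun_upd[where J=N]) auto

text \<open>Here \<open>a\<close> is the sampled copy, not the profile of actual bids. The
  restriction to \<open>J\<close> is there because actions are extensional functions.\<close>

definition sampled_bid :: "nat \<Rightarrow> real \<Rightarrow> nat set \<Rightarrow> (nat \<Rightarrow> nat \<Rightarrow> real) \<Rightarrow> nat \<Rightarrow> real" where
  "sampled_bid i \<epsilon> S a = (\<lambda>j\<in>J. if j \<in> S then rival_bid I i a j + \<epsilon> else 0)"

text \<open>Charging the bids on all of \<open>S\<close>, won or not, gives a bound that is
  independent of the actual rival bids \<open>a'\<close>.\<close>

lemma payment_sampled_bid_le:
  assumes a: "a \<in> space Prof" and "0 \<le> \<epsilon>"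
  shows "payment I i (a'(i := sampled_bid i \<epsilon> S a)) \<le> (\<Sum>j\<in>J. if j \<in> S then rival_bid I i a j + \<epsilon> else 0)"
  unfolding payment_eq using rival_bid_nonneg[OF a] assms(2)
  by (intro sum_mono) (auto simp: sampled_bid_def)

text \<open>The margin \<open>\<epsilon>\<close> makes the deviation independent of the tie order.\<close>

lemma won_items_sampled_bid:
  assumes i: "i \<in> N" and "0 < \<epsilon>"
  shows "{j \<in> S \<inter> J. rival_bid I i a' j \<le> rival_bid I i a j}
    \<subseteq> won_items I i (a'(i := sampled_bid i \<epsilon> S a))"
proof
  fix j assume j: "j \<in> {j \<in> S \<inter> J. rival_bid I i a' j \<le> rival_bid I i a j}"
  let ?w = "a'(i := sampled_bid i \<epsilon> S a)"
  have "rival_bid I i a' j < rival_bid I i a j + \<epsilon>"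
    using j \<open>0 < \<epsilon>\<close> by auto
  then have less: "\<forall>k\<in>N - {i}. a' k j < rival_bid I i a j + \<epsilon>"
    by (simp add: rival_bid_less_iff)
  have w: "?w i j = rival_bid I i a j + \<epsilon>"
    using j by (simp add: sampled_bid_def)
  have "?w k j \<le> ?w i j" if "k \<in> N" for k
    using less that w by (cases "k = i") (auto intro: less_imp_le)
  moreover have "k = i" if "k \<in> N" "?w i j \<le> ?w k j" for k
    using less that w by (cases "k = i") (auto simp: not_le[symmetric])
  ultimately have "highest_bidders I ?w j = {i}"
    using i unfolding highest_bidders_def by blast
  moreover have "(i, i) \<in> tie_order I"
    using inst i by (auto simp: auction_instance_def order_on_defs refl_on_def)
  ultimately show "j \<in> won_items I i ?w"
    using j by (simp add: won_items_def)
qed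

lemma measurable_sampled_bid:
  assumes S: "\<And>j. j \<in> J \<Longrightarrow> Measurable.pred D (\<lambda>x. j \<in> S x)"
    and f: "f \<in> measurable D Prof" and "0 \<le> \<epsilon>"
  shows "(\<lambda>x. sampled_bid i \<epsilon> (S x) (f x)) \<in> measurable D (action_space I)"
  unfolding action_space_def sampled_bid_def
proof (rule measurable_restrict)
  fix j assume j: "j \<in> J"
  have "(\<lambda>x. if j \<in> S x then rival_bid I i (f x) j + \<epsilon> else 0) \<in> borel_measurable D"
    by (intro measurable_If borel_measurable_add borel_measurable_const predE[OF S[OF j]]
        measurable_compose[OF f measurable_rival_bid[OF j]])
  moreover have "0 \<le> rival_bid I i (f x) j" if "x \<in> space D" for x
    using measurable_space[OF f that] j by (rule rival_bid_nonneg)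
  ultimately show "(\<lambda>x. if j \<in> S x then rival_bid I i (f x) j + \<epsilon> else 0) \<in> measurable D (restrict_space borel {0..})"
    using \<open>0 \<le> \<epsilon>\<close> by (intro measurable_restrict_space2) auto
qed

end

subsection \<open>Expectations in equilibrium\<close>

locale auction_equilibrium = subadditive_auction +
  fixes A assumes eq: "coarse_correlated_eq I A"
begin

lemma sets_A [measurable_cong]: "sets A = sets Prof"
  using eq by (simp add: coarse_correlated_eq_def space_prob_algebra)

lemma space_A: "space A = space Prof"
  using sets_A by (rule sets_eq_imp_space_eq)

sublocale prob_space A
  using eq by (simp add: coarse_correlated_eq_def space_prob_algebra)

lemma measurable_ident_A [measurable]: "(\<lambda>a. a) \<in> measurable A Prof"
  by (rule measurable_ident_sets[OF sets_A])

text \<open>A deviation can thus be given by a bid function \<open>\<beta>\<close> on any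
  probability space \<open>D\<close> of private randomness. The full profile may replace the
  marginal, since the coordinate \<open>i\<close> is overwritten anyway.\<close>

lemma deviation_expect_distr:
  assumes D: "prob_space D" and \<beta> [measurable]: "\<beta> \<in> measurable D (action_space I)"
    and i: "i \<in> N" and f [measurable]: "f \<in> borel_measurable Prof"
  shows "deviation_expect i (distr D (action_space I) \<beta>) (others_marginal I i A) f
    = expect (D \<Otimes>\<^sub>M A) (\<lambda>(x, a). f (a(i := \<beta> x)))"
proof -
  let ?K = "N - {i}"
  let ?P = "profile_space I ?K"
  have r [measurable]: "(\<lambda>a. restrict a ?K) \<in> measurable A ?P"
    using measurable_compose[OF measurable_ident_A[unfolded profile_space_def] measurable_restrict_subset[of ?K N]]
    by (simp add: profile_space_def)
  have "prob_space (distr A ?P (\<lambda>a. restrict a ?K))"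
    by (rule prob_space_distr) measurable
  then have "sigma_finite_measure (distr A ?P (\<lambda>a. restrict a ?K))"
    by (rule prob_space_imp_sigma_finite)
  then have pair: "distr D (action_space I) \<beta> \<Otimes>\<^sub>M others_marginal I i A
      = distr (D \<Otimes>\<^sub>M A) (action_space I \<Otimes>\<^sub>M ?P) (\<lambda>(x, a). (\<beta> x, restrict a ?K))"
    unfolding others_marginal_def by (intro pair_measure_distr) measurable
  have "(\<lambda>x. (snd x)(i := fst x)) \<in> measurable (action_space I \<Otimes>\<^sub>M ?P) Prof"
    unfolding profile_space_def
  proof (rule measurable_fun_upd[where J="?K"])
    show "N = ?K \<union> {i}" using i by blast
  qed (rule measurable_fst measurable_snd)+
  from measurable_compose[OF this f]
  have g: "(\<lambda>(b, c). f (c(i := b))) \<in> borel_measurable (action_space I \<Otimes>\<^sub>M ?P)"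
    unfolding case_prod_beta .
  have "deviation_expect i (distr D (action_space I) \<beta>) (others_marginal I i A) f
      = expect (D \<Otimes>\<^sub>M A) (\<lambda>x. case (case x of (x, a) \<Rightarrow> (\<beta> x, restrict a ?K)) of (b, c) \<Rightarrow> f (c(i := b)))"
    unfolding deviation_expect_def pair by (intro expect_distr g) measurable
  also have "\<dots> = expect (D \<Otimes>\<^sub>M A) (\<lambda>(x, a). f (a(i := \<beta> x)))"
  proof (rule expect_cong)
    fix x assume "x \<in> space (D \<Otimes>\<^sub>M A)"
    \<comment> \<open>Profiles are \<open>undefined\<close> outside \<open>N\<close>, so the
      restriction changes only the coordinate \<open>i\<close>, which the update overwrites.\<close>
    then have "snd x \<in> extensional N"
      by (auto simp: space_pair_measure space_A space_profile PiE_def)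
    then have "(restrict (snd x) ?K)(i := \<beta> (fst x)) = (snd x)(i := \<beta> (fst x))"
      using i by (auto simp: fun_eq_iff restrict_def extensional_def)
    then show "(case (case x of (x, a) \<Rightarrow> (\<beta> x, restrict a ?K)) of (b, c) \<Rightarrow> f (c(i := b)))
        = (case x of (x, a) \<Rightarrow> f (a(i := \<beta> x)))"
      by (simp add: case_prod_beta)
  qed
  finally show ?thesis .
qed

lemma measurable_value_A [measurable]: "(\<lambda>a. v i (won_items I i a)) \<in> borel_measurable A"
  by (rule measurable_compose[OF measurable_ident_A measurable_value])

lemma deviation_inequality:
  assumes D: "prob_space D" and \<beta> [measurable]: "\<beta> \<in> measurable D (action_space I)"
    and i: "i \<in> N"
    and budget: "expect (D \<Otimes>\<^sub>M A) (\<lambda>(x, a). payment I i (a(i := \<beta> x))) \<le> budget I i"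
  shows "expect (D \<Otimes>\<^sub>M A) (\<lambda>(x, a). utility I i (a(i := \<beta> x))) \<le> expect A (utility I i)"
proof -
  note meas = measurable_payment[OF i] measurable_utility[OF i]
  have "distr D (action_space I) \<beta> \<in> space (prob_algebra (action_space I))"
    using prob_space.prob_space_distr[OF D \<beta>] by (simp add: space_prob_algebra)
  with budget have "distr D (action_space I) \<beta> \<in> feasible_deviations I i (others_marginal I i A)"
    by (simp add: feasible_deviations_def deviation_expect_distr[OF D \<beta> i meas(1)])
  then show ?thesis
    using eq i unfolding coarse_correlated_eq_def deviation_expect_distr[OF D \<beta> i meas(2), symmetric]
    by blast
qed

section \<open>Integrability of utilities, payments and bids\<close>

lemma measurable_zero_bid: "(\<lambda>_. \<lambda>j\<in>J. 0) \<in> measurable D (action_space I)"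
  by (rule measurable_const) (simp add: space_action)

text \<open>Bidding 0 everywhere costs nothing, so it is feasible under every budget, and its
  utility is a nonnegative value.\<close>

lemma expect_utility_nonneg:
  assumes i: "i \<in> N"
  shows "0 \<le> expect A (utility I i)"
proof -
  \<comment> \<open>The bid is constant; \<open>A\<close> merely serves as some probability space of
    private randomness.\<close>
  let ?\<beta> = "\<lambda>_::nat \<Rightarrow> nat \<Rightarrow> real. \<lambda>j\<in>J. 0::real"
  have zero: "payment I i (a(i := ?\<beta> x)) = 0" for a and x :: "nat \<Rightarrow> nat \<Rightarrow> real"
    using won_items_subset[of i "a(i := ?\<beta> x)"] by (auto simp: payment_def intro!: sum.neutral)
  have "0 \<le> expect (A \<Otimes>\<^sub>M A) (\<lambda>(x, a). utility I i (a(i := ?\<beta> x)))"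
    using i by (intro expect_nonneg) (auto simp: utility_def zero value_bounds)
  also have "\<dots> \<le> expect A (utility I i)"
  proof (rule deviation_inequality[OF prob_space_axioms measurable_zero_bid i])
    show "expect (A \<Otimes>\<^sub>M A) (\<lambda>(x, a). payment I i (a(i := ?\<beta> x))) \<le> budget I i"
      using budget_pos[OF i] by (simp add: zero expect_def case_prod_beta)
  qed
  finally show ?thesis .
qed

lemma integrable_value: "i \<in> N \<Longrightarrow> integrable A (\<lambda>a. v i (won_items I i a))"
  using value_bounds by (intro integrable_const_bound[where B="v i J"]) auto

lemma integrable_utility:
  assumes "i \<in> N"
  shows "integrable A (utility I i)"
proof (rule integrable_of_expect_nonneg[where C="v i J"])
  show "utility I i \<in> borel_measurable A"
    by (rule measurable_compose[OF measurable_ident_A measurable_utility[OF assms]])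
  show "utility I i a \<le> v i J" if "a \<in> space A" for a
    using that payment_nonneg[of a i] value_bounds[OF assms, of a] assms
    by (simp add: utility_def space_A)
qed (rule expect_utility_nonneg[OF assms])

text \<open>An infinite budget puts no bound on the expected payment. Integrability comes instead
  from the utility, which is bounded above and has nonnegative expectation.\<close>

lemma integrable_payment:
  assumes "i \<in> N"
  shows "integrable A (payment I i)"
proof -
  have "payment I i = (\<lambda>a. v i (won_items I i a) - utility I i a)"
    by (simp add: utility_def fun_eq_iff)
  then show ?thesis
    using integrable_value[OF assms] integrable_utility[OF assms] by simp
qed

lemma integral_utility:
  assumes "i \<in> N"
  shows "(\<integral>a. utility I i a \<partial>A) = (\<integral>a. v i (won_items I i a) \<partial>A) - (\<integral>a. payment I i a \<partial>A)"
  unfolding utility_def using assms by (intro Bochner_Integration.integral_diff integrable_value integrable_payment)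

lemma integral_utility_nonneg:
  assumes "i \<in> N"
  shows "0 \<le> (\<integral>a. utility I i a \<partial>A)"
  using expect_utility_nonneg[OF assms] by (simp add: expect_eq_integral integrable_utility assms)

lemma highest_bid_nonneg:
  assumes "a \<in> space Prof" "j \<in> J"
  shows "0 \<le> Max ((\<lambda>k. a k j) ` N)"
  \<comment> \<open>The highest rival bid of an arbitrary index is a nonnegative lower bound, even
    if the index is no bidder.\<close>
  using rival_bid_nonneg[OF assms, of undefined] rival_bid_le_highest order_trans by blast

text \<open>The highest bid on a single item is dominated by the revenue, a finite sum of integrable
  payments.\<close>

lemma integrable_highest_bid:
  assumes j: "j \<in> J"
  shows "integrable A (\<lambda>a. Max ((\<lambda>k. a k j) ` N))"
proof (rule Bochner_Integration.integrable_bound)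
  show "integrable A (\<lambda>a. \<Sum>i\<in>N. payment I i a)"
    by (intro Bochner_Integration.integrable_sum integrable_payment)
  show "(\<lambda>a. Max ((\<lambda>k. a k j) ` N)) \<in> borel_measurable A"
    using j by (intro borel_measurable_Max measurable_compose[OF measurable_ident_A measurable_bid]) auto
  show "AE a in A. norm (Max ((\<lambda>k. a k j) ` N)) \<le> norm (\<Sum>i\<in>N. payment I i a)"
  proof (rule AE_I2)
    fix a assume "a \<in> space A"
    then have a: "a \<in> space Prof" by (simp add: space_A)
    have "Max ((\<lambda>k. a k j) ` N) \<le> (\<Sum>j\<in>J. Max ((\<lambda>k. a k j) ` N))"
      using j highest_bid_nonneg[OF a] by (intro member_le_sum) auto
    also have "\<dots> \<le> (\<Sum>i\<in>N. payment I i a)"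
      by (rule highest_bids_le_revenue[OF a])
    finally show "norm (Max ((\<lambda>k. a k j) ` N)) \<le> norm (\<Sum>i\<in>N. payment I i a)"
      using highest_bid_nonneg[OF a j] by simp
  qed
qed

lemma integrable_rival_bid:
  assumes j: "j \<in> J"
  shows "integrable A (\<lambda>a. rival_bid I i a j)"
proof (rule Bochner_Integration.integrable_bound[OF integrable_highest_bid[OF j]])
  show "(\<lambda>a. rival_bid I i a j) \<in> borel_measurable A"
    by (rule measurable_compose[OF measurable_ident_A measurable_rival_bid[OF j]])
  show "AE a in A. norm (rival_bid I i a j) \<le> norm (Max ((\<lambda>k. a k j) ` N))"
    using rival_bid_nonneg[OF _ j] rival_bid_le_highest[of i _ j]
    by (intro AE_I2) (auto simp: space_A intro: order_trans[OF _ abs_ge_self])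
qed

section \<open>Utility bounds from the deviation\<close>

definition price :: "nat \<Rightarrow> nat \<Rightarrow> real" where
  "price i j = (\<integral>a. rival_bid I i a j \<partial>A)"

lemma price_nonneg: "j \<in> J \<Longrightarrow> 0 \<le> price i j"
  unfolding price_def by (intro integral_nonneg_AE AE_I2 rival_bid_nonneg) (simp_all add: space_A)

text \<open>For two independent samples \<open>a\<close> and \<open>a'\<close>, the set won by bidding \<open>a\<close> against \<open>a'\<close> and the set won by
  bidding \<open>a'\<close> against \<open>a\<close> cover \<open>S\<close>, and their values have the same expectation.\<close>

lemma half_value_won:
  assumes i: "i \<in> N" and S: "S \<subseteq> J"
  shows "v i S / 2 \<le> (\<integral>a. \<integral>a'. v i {j \<in> S. rival_bid I i a' j \<le> rival_bid I i a j} \<partial>A \<partial>A)"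
proof -
  interpret AA: pair_prob_space A A ..
  define h where "h a a' = v i {j \<in> S. rival_bid I i a' j \<le> rival_bid I i a j}" for a a'
  have "finite S" using S finite_items by (rule finite_subset)
  have "(\<lambda>x. h (fst x) (snd x)) \<in> borel_measurable (A \<Otimes>\<^sub>M A)"
    unfolding h_def
  proof (rule borel_measurable_set_valued[OF \<open>finite S\<close>])
    fix j assume j: "j \<in> S"
    then have "j \<in> J" using S by blast
    then have r: "(\<lambda>a. rival_bid I i a j) \<in> borel_measurable A"
      by (intro measurable_compose[OF measurable_ident_A measurable_rival_bid])
    have "Measurable.pred (A \<Otimes>\<^sub>M A) (\<lambda>x. rival_bid I i (snd x) j \<le> rival_bid I i (fst x) j)"
      unfolding pred_def
      by (intro borel_measurable_le measurable_compose[OF measurable_fst r] measurable_compose[OF measurable_snd r])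
    then show "Measurable.pred (A \<Otimes>\<^sub>M A) (\<lambda>x. j \<in> {j \<in> S. rival_bid I i (snd x) j \<le> rival_bid I i (fst x) j})"
      using j by simp
  qed auto
  moreover have bound: "0 \<le> h a a'" "h a a' \<le> v i J" for a a'
    unfolding h_def using S i by (auto intro!: valuation_nonneg valuation_mono)
  ultimately have int: "integrable (A \<Otimes>\<^sub>M A) (case_prod h)"
    by (intro AA.P.integrable_const_bound[where B="v i J"]) (auto simp: case_prod_beta')
  have int': "integrable (A \<Otimes>\<^sub>M A) (\<lambda>(a, a'). h a' a)"
    using AA.integrable_product_swap[OF int] by (simp add: case_prod_beta)
  have swap: "(\<integral>a. \<integral>a'. h a' a \<partial>A \<partial>A) = (\<integral>a. \<integral>a'. h a a' \<partial>A \<partial>A)"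
    using AA.Fubini_integral[OF int] .
  have "v i S \<le> h a a' + h a' a" for a a'
  proof -
    have "S = {j \<in> S. rival_bid I i a' j \<le> rival_bid I i a j} \<union> {j \<in> S. rival_bid I i a j \<le> rival_bid I i a' j}"
      by auto
    then show ?thesis
      unfolding h_def using valuation_subadd[OF i, of "{j \<in> S. rival_bid I i a' j \<le> rival_bid I i a j}"
        "{j \<in> S. rival_bid I i a j \<le> rival_bid I i a' j}"] S by auto
  qed
  then have "(\<integral>x. v i S \<partial>(A \<Otimes>\<^sub>M A)) \<le> (\<integral>x. (case_prod h x + (case x of (a, a') \<Rightarrow> h a' a)) \<partial>(A \<Otimes>\<^sub>M A))"
    by (intro integral_mono Bochner_Integration.integrable_add int int') auto
  also have "\<dots> = (\<integral>x. case_prod h x \<partial>(A \<Otimes>\<^sub>M A)) + (\<integral>(a, a'). h a' a \<partial>(A \<Otimes>\<^sub>M A))"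
    by (rule Bochner_Integration.integral_add[OF int int'])
  also have "\<dots> = 2 * (\<integral>a. \<integral>a'. h a a' \<partial>A \<partial>A)"
    using AA.integral_fst'[OF int] AA.integral_fst'[OF int'] swap by simp
  finally show ?thesis
    by (simp add: AA.P.prob_space h_def)
qed

text \<open>The distribution \<open>\<sigma>\<close> of the set is arbitrary, and feasibility is an
  assumption on the cost of all its bids; adapting \<open>\<sigma>\<close> to the budget is left to
  \<open>utility_lower_bound\<close>. As \<open>\<sigma>\<close> may produce non-items, the value is
  that of \<open>S \<inter> J\<close>.\<close>

lemma deviation_bound:
  assumes i: "i \<in> N" and \<epsilon>: "0 < \<epsilon>"
    and budget: "ereal (\<integral>S. (\<Sum>j\<in>J. if j \<in> S then price i j + \<epsilon> else 0) \<partial>measure_pmf \<sigma>) \<le> budget I i"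
  shows "(\<integral>S. v i (S \<inter> J) \<partial>measure_pmf \<sigma>) / 2
      - (\<integral>S. (\<Sum>j\<in>J. if j \<in> S then price i j + \<epsilon> else 0) \<partial>measure_pmf \<sigma>)
    \<le> (\<integral>a. utility I i a \<partial>A)"
proof -
  let ?\<sigma> = "measure_pmf \<sigma>"
  \<comment> \<open>\<open>?D\<close> holds the private randomness of the deviation, namely the set
    and the sampled profile. The last factor of \<open>?D \<Otimes>\<^sub>M A\<close> holds the
    actual bids.\<close>
  let ?D = "?\<sigma> \<Otimes>\<^sub>M A"
  define c where "c S a = (\<Sum>j\<in>J. if j \<in> S then rival_bid I i a j + \<epsilon> else 0)" for S a
  define C where "C S = (\<Sum>j\<in>J. if j \<in> S then price i j + \<epsilon> else 0)" for S
  define \<beta> where "\<beta> x = sampled_bid i \<epsilon> (fst x) (snd x)" for x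
  \<comment> \<open>The value of those items on which the sampled threshold reaches the actual one:
    it bounds the value won from below, and \<open>half_value_won\<close> bounds its mean from
    below.\<close>
  define g where "g S a a' = v i {j \<in> S \<inter> J. rival_bid I i a' j \<le> rival_bid I i a j}" for S a a'
  interpret D: pair_prob_space ?\<sigma> A ..
  interpret DA: pair_prob_space ?D A ..
  have pD: "prob_space ?D"
    by (rule prob_space_pair[OF measure_pmf.prob_space_axioms prob_space_axioms])
  have meas_S: "Measurable.pred ?D (\<lambda>x. j \<in> fst x)" for j
    by (rule measurable_compose[OF measurable_fst]) simp
  have snd_Prof: "snd \<in> measurable ?D Prof"
    using measurable_compose[OF measurable_snd measurable_ident_A] by simp
  have \<beta>: "\<beta> \<in> measurable ?D (action_space I)"
    unfolding \<beta>_def using \<epsilon> by (intro measurable_sampled_bid meas_S snd_Prof) auto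

  have int_c: "integrable A (c S)" and C_eq: "(\<integral>a. c S a \<partial>A) = C S" for S
  proof -
    have *: "integrable A (\<lambda>a. if j \<in> S then rival_bid I i a j + \<epsilon> else 0)"
      "(\<integral>a. (if j \<in> S then rival_bid I i a j + \<epsilon> else 0) \<partial>A) = (if j \<in> S then price i j + \<epsilon> else 0)"
      if "j \<in> J" for j
      using integrable_rival_bid[OF that, of i] by (cases "j \<in> S"; simp add: price_def prob_space)+
    show "integrable A (c S)"
      unfolding c_def using * by (intro Bochner_Integration.integrable_sum) auto
    show "(\<integral>a. c S a \<partial>A) = C S"
      unfolding c_def C_def using * by (subst Bochner_Integration.integral_sum) auto
  qed
  have c_nonneg: "0 \<le> c S a" if "a \<in> space A" for S a
    unfolding c_def using that \<epsilon> rival_bid_nonneg by (intro sum_nonneg) (auto simp: space_A)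
  have C_bound: "norm (C S) \<le> (\<Sum>j\<in>J. price i j + \<epsilon>)" for S
  proof -
    have "0 \<le> C S" "C S \<le> (\<Sum>j\<in>J. price i j + \<epsilon>)"
      unfolding C_def using \<epsilon> price_nonneg by (auto intro!: sum_nonneg sum_mono add_nonneg_nonneg)
    then show ?thesis by simp
  qed
  have int_C: "integrable ?\<sigma> C"
    using C_bound by (intro measure_pmf.integrable_const_bound) auto
  have c_meas: "(\<lambda>x. c (fst x) (snd x)) \<in> borel_measurable ?D"
    unfolding c_def
    by (intro borel_measurable_sum measurable_If borel_measurable_add borel_measurable_const
        predE[OF meas_S] measurable_compose[OF snd_Prof measurable_rival_bid])
  \<comment> \<open>The cost is nonnegative, so its norm integrates over \<open>A\<close> to
    \<open>C S\<close>, which is bounded in \<open>S\<close>. This gives joint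
    integrability.\<close>
  have int_cD: "integrable ?D (\<lambda>x. c (fst x) (snd x))"
  proof (rule D.Fubini_integrable[OF c_meas])
    have "(\<integral>a. norm (c S a) \<partial>A) = C S" for S
      unfolding C_eq[symmetric] using c_nonneg by (intro Bochner_Integration.integral_cong) auto
    then show "integrable ?\<sigma> (\<lambda>S. \<integral>a. norm (c (fst (S, a)) (snd (S, a))) \<partial>A)"
      using int_C by simp
  qed (simp add: int_c)
  have cD: "(\<integral>x. c (fst x) (snd x) \<partial>?D) = (\<integral>S. C S \<partial>?\<sigma>)"
    using D.integral_fst'[OF int_cD] by (simp add: C_eq)
  have int_cDA: "integrable (?D \<Otimes>\<^sub>M A) (\<lambda>(x, a'). c (fst x) (snd x))"
    and cDA: "(\<integral>(x, a'). c (fst x) (snd x) \<partial>(?D \<Otimes>\<^sub>M A)) = (\<integral>S. C S \<partial>?\<sigma>)"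
    using integrable_pair_fst[OF pD prob_space_axioms int_cD] cD by auto

  have dev: "(\<lambda>x. (snd x)(i := \<beta> (fst x))) \<in> measurable (?D \<Otimes>\<^sub>M A) Prof"
    using i by (intro measurable_deviation measurable_compose[OF measurable_fst \<beta>]
        measurable_compose[OF measurable_snd measurable_ident_A])
  have pay_le: "payment I i (a'(i := \<beta> x)) \<le> c (fst x) (snd x)" if "x \<in> space ?D" for x a'
    unfolding \<beta>_def c_def using that \<epsilon>
    by (intro payment_sampled_bid_le) (auto simp: space_pair_measure space_A)
  have pay_nonneg: "0 \<le> payment I i ((snd x)(i := \<beta> (fst x)))" if "x \<in> space (?D \<Otimes>\<^sub>M A)" for x
    using measurable_space[OF dev that] i by (rule payment_nonneg)
  have int_pay: "integrable (?D \<Otimes>\<^sub>M A) (\<lambda>(x, a'). payment I i (a'(i := \<beta> x)))"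
  proof (rule Bochner_Integration.integrable_bound[OF int_cDA])
    show "(\<lambda>(x, a'). payment I i (a'(i := \<beta> x))) \<in> borel_measurable (?D \<Otimes>\<^sub>M A)"
      using measurable_compose[OF dev measurable_payment[OF i]] unfolding case_prod_beta .
    show "AE x in ?D \<Otimes>\<^sub>M A. norm (case x of (x, a') \<Rightarrow> payment I i (a'(i := \<beta> x)))
        \<le> norm (case x of (x, a') \<Rightarrow> c (fst x) (snd x))"
    proof (rule AE_I2)
      fix x assume x: "x \<in> space (?D \<Otimes>\<^sub>M A)"
      then have "fst x \<in> space ?D" by (auto simp: space_pair_measure)
      from pay_le[OF this] pay_nonneg[OF x] show "norm (case x of (x, a') \<Rightarrow> payment I i (a'(i := \<beta> x)))
        \<le> norm (case x of (x, a') \<Rightarrow> c (fst x) (snd x))"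
        unfolding case_prod_beta real_norm_def by (smt (verit))
    qed
  qed
  have pay_int: "(\<integral>(x, a'). payment I i (a'(i := \<beta> x)) \<partial>(?D \<Otimes>\<^sub>M A)) \<le> (\<integral>(x, a'). c (fst x) (snd x) \<partial>(?D \<Otimes>\<^sub>M A))"
    using pay_le by (intro integral_mono int_pay int_cDA) (auto simp: space_pair_measure)
  \<comment> \<open>The expected payment is at most the expected cost of all bids, so the assumption
    on that cost makes the deviation feasible.\<close>
  then have "expect (?D \<Otimes>\<^sub>M A) (\<lambda>(x, a'). payment I i (a'(i := \<beta> x))) \<le> ereal (\<integral>S. C S \<partial>?\<sigma>)"
    by (simp add: expect_eq_integral[OF int_pay] cDA)
  also have "\<dots> \<le> budget I i"
    using budget by (simp add: C_def)
  finally have le: "expect (?D \<Otimes>\<^sub>M A) (\<lambda>(x, a'). utility I i (a'(i := \<beta> x))) \<le> expect A (utility I i)"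
    by (intro deviation_inequality pD \<beta> i)

  have int_val: "integrable (?D \<Otimes>\<^sub>M A) (\<lambda>(x, a'). v i (won_items I i (a'(i := \<beta> x))))"
  proof (rule DA.P.integrable_const_bound[where B="v i J"])
    show "(\<lambda>(x, a'). v i (won_items I i (a'(i := \<beta> x)))) \<in> borel_measurable (?D \<Otimes>\<^sub>M A)"
      using measurable_compose[OF dev measurable_value] unfolding case_prod_beta .
  qed (use value_bounds[OF i] in \<open>auto simp: case_prod_beta\<close>)
  have int_util: "integrable (?D \<Otimes>\<^sub>M A) (\<lambda>(x, a'). utility I i (a'(i := \<beta> x)))"
    using Bochner_Integration.integrable_diff[OF int_val int_pay]
    unfolding utility_def case_prod_beta .
  have util: "(\<integral>(x, a'). utility I i (a'(i := \<beta> x)) \<partial>(?D \<Otimes>\<^sub>M A)) \<le> (\<integral>a. utility I i a \<partial>A)"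
    using le by (simp add: expect_eq_integral int_util integrable_utility i)

  have g_bound: "0 \<le> g S a a'" "g S a a' \<le> v i J" for S a a'
    unfolding g_def using i by (auto intro!: valuation_nonneg valuation_mono)
  have g_meas: "(\<lambda>x. g (fst (fst x)) (snd (fst x)) (snd x)) \<in> borel_measurable (?D \<Otimes>\<^sub>M A)"
    unfolding g_def
  proof (rule borel_measurable_set_valued[OF finite_items])
    fix j assume j: "j \<in> J"
    note r = measurable_compose[OF measurable_compose[OF measurable_snd measurable_ident_A] measurable_rival_bid[OF j]]
    have "Measurable.pred (?D \<Otimes>\<^sub>M A) (\<lambda>x. rival_bid I i (snd x) j \<le> rival_bid I i (snd (fst x)) j)"
      unfolding pred_def by (intro borel_measurable_le r measurable_compose[OF measurable_fst r])
    moreover have "Measurable.pred (?D \<Otimes>\<^sub>M A) (\<lambda>x. j \<in> fst (fst x))"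
      by (rule measurable_compose[OF measurable_fst meas_S])
    ultimately have "Measurable.pred (?D \<Otimes>\<^sub>M A) (\<lambda>x. j \<in> fst (fst x) \<and> rival_bid I i (snd x) j \<le> rival_bid I i (snd (fst x)) j)"
      by (intro pred_intros_logic)
    then show "Measurable.pred (?D \<Otimes>\<^sub>M A) (\<lambda>x. j \<in> {j \<in> fst (fst x) \<inter> J. rival_bid I i (snd x) j \<le> rival_bid I i (snd (fst x)) j})"
      using j by simp
  qed auto
  have int_g: "integrable (?D \<Otimes>\<^sub>M A) (\<lambda>x. g (fst (fst x)) (snd (fst x)) (snd x))"
    using g_bound by (intro DA.P.integrable_const_bound[where B="v i J"] g_meas) auto
  have int_g': "integrable ?D (\<lambda>x. \<integral>a'. g (fst x) (snd x) a' \<partial>A)"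
    using DA.integrable_fst'[OF int_g] by simp
  \<comment> \<open>\<open>half_value_won\<close> is applied to each fixed set and averaged over
    \<open>\<sigma>\<close>. Fubini merges the integrals, and \<open>won_items_sampled_bid\<close>
    compares \<open>g\<close> with the value actually won.\<close>
  have "(\<integral>S. v i (S \<inter> J) \<partial>?\<sigma>) / 2 = (\<integral>S. v i (S \<inter> J) / 2 \<partial>?\<sigma>)"
    by simp
  also have "\<dots> \<le> (\<integral>S. (\<integral>a. \<integral>a'. g S a a' \<partial>A \<partial>A) \<partial>?\<sigma>)"
  proof (rule integral_mono)
    show "integrable ?\<sigma> (\<lambda>S. v i (S \<inter> J) / 2)"
      using i valuation_nonneg[OF i] valuation_mono[OF i, of _ J]
      by (intro Bochner_Integration.integrable_divide measure_pmf.integrable_const_bound[where B="v i J"]) auto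
    show "integrable ?\<sigma> (\<lambda>S. \<integral>a. \<integral>a'. g S a a' \<partial>A \<partial>A)"
      using D.integrable_fst'[OF int_g'] by simp
    show "v i (S \<inter> J) / 2 \<le> (\<integral>a. \<integral>a'. g S a a' \<partial>A \<partial>A)" for S
      unfolding g_def by (rule half_value_won[OF i]) simp
  qed
  also have "\<dots> = (\<integral>x. g (fst (fst x)) (snd (fst x)) (snd x) \<partial>(?D \<Otimes>\<^sub>M A))"
    using D.integral_fst'[OF int_g'] DA.integral_fst'[OF int_g] by simp
  also have "\<dots> \<le> (\<integral>(x, a'). v i (won_items I i (a'(i := \<beta> x))) \<partial>(?D \<Otimes>\<^sub>M A))"
  proof (rule integral_mono[OF int_g int_val])
    fix x
    have "g (fst (fst x)) (snd (fst x)) (snd x) \<le> v i (won_items I i ((snd x)(i := \<beta> (fst x))))"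
      unfolding g_def \<beta>_def by (intro valuation_mono won_items_sampled_bid i \<epsilon> won_items_subset)
    then show "g (fst (fst x)) (snd (fst x)) (snd x) \<le> (case x of (x, a') \<Rightarrow> v i (won_items I i (a'(i := \<beta> x))))"
      by (simp add: case_prod_beta)
  qed
  finally have won: "(\<integral>S. v i (S \<inter> J) \<partial>?\<sigma>) / 2 \<le> (\<integral>(x, a'). v i (won_items I i (a'(i := \<beta> x))) \<partial>(?D \<Otimes>\<^sub>M A))" .
  have "(\<integral>(x, a'). utility I i (a'(i := \<beta> x)) \<partial>(?D \<Otimes>\<^sub>M A))
      = (\<integral>(x, a'). v i (won_items I i (a'(i := \<beta> x))) \<partial>(?D \<Otimes>\<^sub>M A))
        - (\<integral>(x, a'). payment I i (a'(i := \<beta> x)) \<partial>(?D \<Otimes>\<^sub>M A))"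
    using Bochner_Integration.integral_diff[OF int_val int_pay]
    unfolding utility_def case_prod_beta .
  moreover have "(\<integral>(x, a'). payment I i (a'(i := \<beta> x)) \<partial>(?D \<Otimes>\<^sub>M A)) \<le> (\<integral>S. C S \<partial>?\<sigma>)"
    using pay_int cDA by simp
  ultimately show ?thesis
    using util won unfolding C_def by linarith
qed

text \<open>Thinning \<open>\<rho>\<close> brings its expected value down to \<open>r\<close>, which
  fits the budget. Either the thinned deviation is feasible, or its cost exceeds \<open>r\<close>
  and the bound is weak enough to follow from nonnegative utility. Proving the claim up to every
  \<open>\<delta> > 0\<close> removes the bidding margin.\<close>

lemma utility_lower_bound:
  fixes \<rho> :: "nat set pmf"
  assumes i: "i \<in> N" and r: "0 \<le> r" "ereal r \<le> budget I i"
    and le: "r \<le> (\<integral>S. v i (S \<inter> J) \<partial>measure_pmf \<rho>)"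
  shows "r / 2 - (\<integral>S. (\<Sum>j\<in>J. if j \<in> S then price i j else 0) \<partial>measure_pmf \<rho>)
    \<le> (\<integral>a. utility I i a \<partial>A)" (is "_ - ?Q \<le> ?U")
proof (rule field_le_epsilon)
  fix \<delta> :: real assume \<delta>: "0 < \<delta>"
  \<comment> \<open>The margins on all items together add at most \<open>\<delta>\<close> to the
    cost; the \<open>+ 1\<close> keeps the denominator visibly positive.\<close>
  define \<epsilon> where "\<epsilon> = \<delta> / (card J + 1)"
  have \<epsilon>: "0 < \<epsilon>" "card J * \<epsilon> \<le> \<delta>"
    using \<delta> by (auto simp: \<epsilon>_def field_simps)
  define W where "W S = v i (S \<inter> J)" for S
  define C where "C S = (\<Sum>j\<in>J. if j \<in> S then price i j + \<epsilon> else 0)" for S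
  define V where "V = (\<integral>S. W S \<partial>measure_pmf \<rho>)"
  \<comment> \<open>The probability of keeping the set drawn from \<open>\<rho>\<close>. If
    \<open>V = 0\<close> then also \<open>r = 0\<close>, so that \<open>\<gamma> * V = r\<close>
    holds in both cases.\<close>
  define \<gamma> where "\<gamma> = (if V = 0 then 0 else r / V)"
  have "r \<le> V" using le by (simp add: V_def W_def)
  then have \<gamma>: "0 \<le> \<gamma>" "\<gamma> \<le> 1" "\<gamma> * V = r"
    using r by (auto simp: \<gamma>_def)
  define \<sigma> where "\<sigma> = bind_pmf (bernoulli_pmf \<gamma>) (\<lambda>b. if b then \<rho> else return_pmf {})"

  have C_bounds: "0 \<le> C S" "C S \<le> (\<Sum>j\<in>J. price i j + \<epsilon>)" for S
    unfolding C_def using \<epsilon> price_nonneg by (auto intro!: sum_nonneg sum_mono add_nonneg_nonneg)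
  have W_bounds: "0 \<le> W S" "W S \<le> v i J" for S
    unfolding W_def using i by (auto intro!: valuation_nonneg valuation_mono)
  \<comment> \<open>The empty set contributes nothing, so thinning scales the integral. The
    nonnegative integral serves to compute it without integrability conditions.\<close>
  have mix: "(\<integral>S. f S \<partial>measure_pmf \<sigma>) = \<gamma> * (\<integral>S. f S \<partial>measure_pmf \<rho>)"
    if "f {} = 0" "\<And>S. 0 \<le> f S" for f :: "nat set \<Rightarrow> real"
  proof -
    have "(\<integral>S. f S \<partial>measure_pmf \<sigma>) = enn2real (\<integral>\<^sup>+S. ennreal (f S) \<partial>measure_pmf \<sigma>)"
      using that by (intro integral_eq_nn_integral) auto
    also have "(\<integral>\<^sup>+S. ennreal (f S) \<partial>measure_pmf \<sigma>) = ennreal \<gamma> * (\<integral>\<^sup>+S. ennreal (f S) \<partial>measure_pmf \<rho>)"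
      using \<gamma> that(1) by (simp add: \<sigma>_def mult.commute)
    also have "enn2real \<dots> = \<gamma> * enn2real (\<integral>\<^sup>+S. ennreal (f S) \<partial>measure_pmf \<rho>)"
      using \<gamma> by (simp add: enn2real_mult)
    also have "enn2real (\<integral>\<^sup>+S. ennreal (f S) \<partial>measure_pmf \<rho>) = (\<integral>S. f S \<partial>measure_pmf \<rho>)"
      using that by (intro integral_eq_nn_integral[symmetric]) auto
    finally show ?thesis .
  qed
  have val: "(\<integral>S. W S \<partial>measure_pmf \<sigma>) = r"
    using mix[of W] W_bounds \<gamma>(3) valuation_empty[OF i] by (simp add: V_def W_def)
  have cost: "(\<integral>S. C S \<partial>measure_pmf \<sigma>) = \<gamma> * (\<integral>S. C S \<partial>measure_pmf \<rho>)"
    using mix[of C] C_bounds by (simp add: C_def)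
  have int_price: "integrable (measure_pmf \<rho>) (\<lambda>S. \<Sum>j\<in>J. if j \<in> S then price i j else 0)"
    by (intro Bochner_Integration.integrable_sum measure_pmf.integrable_const_bound[where B="\<bar>price i _\<bar>"]) auto
  have "(\<integral>S. C S \<partial>measure_pmf \<rho>) \<le> (\<integral>S. (\<Sum>j\<in>J. if j \<in> S then price i j else 0) + card J * \<epsilon> \<partial>measure_pmf \<rho>)"
  proof (rule integral_mono)
    show "integrable (measure_pmf \<rho>) C"
      using C_bounds by (intro measure_pmf.integrable_const_bound[where B="\<Sum>j\<in>J. price i j + \<epsilon>"]) auto
    show "C S \<le> (\<Sum>j\<in>J. if j \<in> S then price i j else 0) + card J * \<epsilon>" for S
    proof -
      have "C S \<le> (\<Sum>j\<in>J. (if j \<in> S then price i j else 0) + \<epsilon>)"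
        unfolding C_def using \<epsilon> by (intro sum_mono) auto
      then show ?thesis by (simp add: sum.distrib)
    qed
  qed (intro Bochner_Integration.integrable_add int_price; simp)
  also have "\<dots> = ?Q + card J * \<epsilon>"
    using int_price by simp
  also have "\<dots> \<le> ?Q + \<delta>"
    using \<epsilon> by simp
  finally have "(\<integral>S. C S \<partial>measure_pmf \<rho>) \<le> ?Q + \<delta>" .
  moreover have "\<gamma> * (\<integral>S. C S \<partial>measure_pmf \<rho>) \<le> (\<integral>S. C S \<partial>measure_pmf \<rho>)"
    using \<gamma> C_bounds by (intro mult_left_le_one_le integral_nonneg_AE) auto
  ultimately have cost_le: "(\<integral>S. C S \<partial>measure_pmf \<sigma>) \<le> ?Q + \<delta>"
    by (simp add: cost)
  show "r / 2 - ?Q \<le> ?U + \<delta>"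
  proof (cases "ereal (\<integral>S. C S \<partial>measure_pmf \<sigma>) \<le> budget I i")
    case True
    then show ?thesis
      using deviation_bound[OF i \<epsilon>(1), of \<sigma>] cost_le val
      unfolding C_def[symmetric] W_def[symmetric] by simp
  next
    case False
    \<comment> \<open>Here \<open>r\<close> is below the cost and hence below
      \<open>?Q + \<delta>\<close>, so \<open>r / 2 - ?Q\<close> is below \<open>\<delta>\<close>,
      while the equilibrium utility is nonnegative.\<close>
    then have "ereal r < ereal (\<integral>S. C S \<partial>measure_pmf \<sigma>)"
      using r(2) by (meson not_le order_le_less_trans)
    then show ?thesis
      using cost_le integral_utility_nonneg[OF i] r(1) by simp
  qed
qed

section \<open>Summation over the bidders\<close>

lemma finite_allocations: "finite (allocations I)"
proof (rule finite_subset)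
  show "allocations I \<subseteq> N \<rightarrow>\<^sub>E Pow J" by (auto simp: allocations_def)
qed (auto intro: finite_PiE)

text \<open>By disjointness each item is charged to at most one bidder, at a price not above its
  expected highest bid. The highest bids sum to at most the revenue.\<close>

lemma sum_price_le:
  assumes x: "x \<in> allocations I"
  shows "(\<Sum>i\<in>N. \<Sum>j\<in>J. if j \<in> x i then price i j else 0) \<le> (\<Sum>i\<in>N. \<integral>a. payment I i a \<partial>A)"
proof -
  define top where "top j = (\<integral>a. Max ((\<lambda>k. a k j) ` N) \<partial>A)" for j
  have "(\<Sum>i\<in>N. \<Sum>j\<in>J. if j \<in> x i then price i j else 0) = (\<Sum>j\<in>J. \<Sum>i\<in>N. if j \<in> x i then price i j else 0)"
    by (rule sum.swap)
  also have "\<dots> \<le> (\<Sum>j\<in>J. top j)"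
  proof (rule sum_mono)
    fix j assume j: "j \<in> J"
    have top: "0 \<le> top j" "price i j \<le> top j" for i
    proof -
      show "price i j \<le> top j"
        unfolding price_def top_def
        by (intro integral_mono integrable_rival_bid integrable_highest_bid j rival_bid_le_highest)
      then show "0 \<le> top j" using price_nonneg[OF j, of i] by simp
    qed
    show "(\<Sum>i\<in>N. if j \<in> x i then price i j else 0) \<le> top j"
    proof (cases "\<exists>i\<in>N. j \<in> x i")
      case True
      then obtain i where i: "i \<in> N" "j \<in> x i" by blast
      have "j \<in> x k \<longleftrightarrow> k = i" if "k \<in> N" for k
        using x that i unfolding allocations_def disjoint_family_on_def by blast
      then have "(\<Sum>k\<in>N. if j \<in> x k then price k j else 0) = (\<Sum>k\<in>N. if k = i then price k j else 0)"
        by (intro sum.cong) auto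
      then show ?thesis using i top by simp
    next
      case False
      then have "(\<Sum>k\<in>N. if j \<in> x k then price k j else 0) = 0"
        by (intro sum.neutral) auto
      then show ?thesis using top by simp
    qed
  qed
  also have "\<dots> = (\<integral>a. (\<Sum>j\<in>J. Max ((\<lambda>k. a k j) ` N)) \<partial>A)"
    unfolding top_def by (intro Bochner_Integration.integral_sum[symmetric] integrable_highest_bid)
  also have "\<dots> \<le> (\<integral>a. (\<Sum>i\<in>N. payment I i a) \<partial>A)"
    by (intro integral_mono Bochner_Integration.integrable_sum integrable_highest_bid integrable_payment
        highest_bids_le_revenue) (simp_all add: space_A)
  also have "\<dots> = (\<Sum>i\<in>N. \<integral>a. payment I i a \<partial>A)"
    by (intro Bochner_Integration.integral_sum integrable_payment)
  finally show ?thesis .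
qed

text \<open>A real number suffices because the expected value is finite even if the budget is not;
  the accounting then takes place in linear real arithmetic.\<close>

definition liquid_value :: "nat \<Rightarrow> real" where
  "liquid_value i = real_of_ereal (min (expect A (\<lambda>a. v i (won_items I i a))) (budget I i))"

lemma liquid_value:
  assumes i: "i \<in> N"
  shows "min (expect A (\<lambda>a. v i (won_items I i a))) (budget I i) = ereal (liquid_value i)" "0 \<le> liquid_value i"
proof -
  have "0 \<le> (\<integral>a. v i (won_items I i a) \<partial>A)"
    using value_bounds[OF i] by simp
  then show "min (expect A (\<lambda>a. v i (won_items I i a))) (budget I i) = ereal (liquid_value i)" "0 \<le> liquid_value i"
    using budget_pos[OF i] unfolding liquid_value_def expect_eq_integral[OF integrable_value[OF i]]
    by (cases "budget I i"; simp add: min_def)+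
qed

lemma liquid_welfare_eq: "liquid_welfare I A = ereal (\<Sum>i\<in>N. liquid_value i)"
  by (simp add: liquid_welfare_def liquid_value(1))

lemma allocation_welfare_le:
  assumes p: "set_pmf p \<subseteq> allocations I"
  shows "(\<Sum>i\<in>N. min (expect (measure_pmf p) (\<lambda>x. v i (x i))) (budget I i)) \<le> 3 * liquid_welfare I A"
proof -
  define P where "P i = (\<integral>a. payment I i a \<partial>A)" for i
  define Q where "Q i = (\<integral>x. (\<Sum>j\<in>J. if j \<in> x i then price i j else 0) \<partial>measure_pmf p)" for i
  have "finite (set_pmf p)"
    using p finite_allocations by (rule finite_subset)
  then have int: "integrable (measure_pmf p) f" for f :: "_ \<Rightarrow> real"
    by (rule integrable_measure_pmf_finite)
  have bidder: "min (expect (measure_pmf p) (\<lambda>x. v i (x i))) (budget I i) \<le> ereal (3 * liquid_value i - 2 * P i + 2 * Q i)"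
    if i: "i \<in> N" for i
  proof -
    define V where "V = (\<integral>x. v i (x i) \<partial>measure_pmf p)"
    define r where "r = real_of_ereal (min (ereal V) (budget I i))"
    have sub: "x i \<subseteq> J" if "x \<in> set_pmf p" for x
      using p that i by (auto simp: allocations_def)
    \<comment> \<open>On the support of \<open>p\<close> the intersection with \<open>J\<close>
      changes nothing; it matches the form of \<open>utility_lower_bound\<close>.\<close>
    have V: "V = (\<integral>S. v i (S \<inter> J) \<partial>measure_pmf (map_pmf (\<lambda>x. x i) p))"
      unfolding V_def integral_map_pmf using sub
      by (intro integral_cong_AE) (auto simp: AE_measure_pmf_iff Int_absorb2)
    have "0 \<le> V"
      unfolding V_def using sub valuation_nonneg[OF i]
      by (intro integral_nonneg_AE) (auto simp: AE_measure_pmf_iff)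
    then have r: "min (ereal V) (budget I i) = ereal r" "0 \<le> r"
      using budget_pos[OF i] unfolding r_def by (cases "budget I i"; simp add: min_def)+
    then have "ereal r \<le> ereal V" and r_budget: "ereal r \<le> budget I i"
      by (metis min.cobounded1, metis min.cobounded2)
    then have "r / 2 - Q i \<le> (\<integral>a. utility I i a \<partial>A)"
      using utility_lower_bound[OF i r(2), of "map_pmf (\<lambda>x. x i) p"] V
      by (simp add: Q_def)
    then have u: "r / 2 - Q i \<le> (\<integral>a. v i (won_items I i a) \<partial>A) - P i"
      by (simp add: integral_utility[OF i] P_def)
    have "ereal (P i) \<le> budget I i"
      using eq i by (simp add: coarse_correlated_eq_def P_def expect_eq_integral[OF integrable_payment[OF i], symmetric])
    moreover have "P i \<le> (\<integral>a. v i (won_items I i a) \<partial>A)"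
      using integral_utility_nonneg[OF i] by (simp add: integral_utility[OF i] P_def)
    \<comment> \<open>The expected payment is below both terms of the minimum: below the budget by
      the equilibrium condition, and below the value by nonnegative utility.\<close>
    ultimately have P: "P i \<le> liquid_value i"
      using liquid_value(1)[OF i] by (simp add: expect_eq_integral[OF integrable_value[OF i]] min_def split: if_splits)
    have "0 \<le> Q i"
      unfolding Q_def using price_nonneg by (intro integral_nonneg_AE) (auto intro!: sum_nonneg)
    have "liquid_value i = (\<integral>a. v i (won_items I i a) \<partial>A) \<or> budget I i = ereal (liquid_value i)"
      using liquid_value(1)[OF i] by (auto simp: expect_eq_integral[OF integrable_value[OF i]] min_def split: if_splits)
    \<comment> \<open>Uncapped, doubling \<open>u\<close> gives
      \<open>r \<le> 2 * l - 2 * P i + 2 * Q i\<close> with \<open>l = liquid_value i\<close>, and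
      \<open>l \<ge> 0\<close>. Capped, \<open>r \<le> l\<close>, and the rest
      \<open>2 * (l - P i) + 2 * Q i\<close> is nonnegative.\<close>
    then have "r \<le> 3 * liquid_value i - 2 * P i + 2 * Q i"
    proof
      assume "liquid_value i = (\<integral>a. v i (won_items I i a) \<partial>A)"
      then show ?thesis using u liquid_value(2)[OF i] by simp
    next
      assume "budget I i = ereal (liquid_value i)"
      then show ?thesis using r_budget P \<open>0 \<le> Q i\<close> by simp
    qed
    then show ?thesis
      using r by (simp add: expect_eq_integral[OF int] V_def)
  qed
  have "(\<Sum>i\<in>N. Q i) = (\<integral>x. (\<Sum>i\<in>N. \<Sum>j\<in>J. if j \<in> x i then price i j else 0) \<partial>measure_pmf p)"
    unfolding Q_def by (intro Bochner_Integration.integral_sum[symmetric] int)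
  also have "\<dots> \<le> (\<integral>x. (\<Sum>i\<in>N. P i) \<partial>measure_pmf p)"
    unfolding P_def using p sum_price_le
    by (intro integral_mono_AE int) (auto simp: AE_measure_pmf_iff)
  finally have Q: "(\<Sum>i\<in>N. Q i) \<le> (\<Sum>i\<in>N. P i)" by simp
  have "(\<Sum>i\<in>N. min (expect (measure_pmf p) (\<lambda>x. v i (x i))) (budget I i))
      \<le> (\<Sum>i\<in>N. ereal (3 * liquid_value i - 2 * P i + 2 * Q i))"
    by (intro sum_mono bidder)
  also have "\<dots> = ereal (3 * (\<Sum>i\<in>N. liquid_value i) - 2 * (\<Sum>i\<in>N. P i) + 2 * (\<Sum>i\<in>N. Q i))"
    by (simp add: sum.distrib sum_subtractf sum_distrib_left)
  also have "\<dots> \<le> ereal (3 * (\<Sum>i\<in>N. liquid_value i))"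
    using Q by simp
  finally show ?thesis
    by (simp add: liquid_welfare_eq)
qed

lemma opt_welfare_le: "opt_welfare I \<le> 3 * liquid_welfare I A"
  unfolding opt_welfare_def by (intro SUP_least allocation_welfare_le) simp

lemma opt_ratio_le: "opt_welfare I / liquid_welfare I A \<le> 3"
proof -
  define l where "l = (\<Sum>i\<in>N. liquid_value i)"
  have l: "liquid_welfare I A = ereal l" "0 \<le> l"
    using liquid_value(2) by (auto simp: liquid_welfare_eq l_def intro: sum_nonneg)
  show ?thesis
  proof (cases "l = 0")
    \<comment> \<open>The optimum is then at most 0, and dividing it by 0 gives 0 or
      -\<infinity>.\<close>
    case True
    then have "opt_welfare I \<le> 0"
      using opt_welfare_le l by (simp add: zero_ereal_def)
    then have "opt_welfare I / 0 \<le> 0"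
      by (cases "opt_welfare I") (auto simp: divide_ereal_def)
    also have "\<dots> \<le> 3" by simp
    finally show ?thesis using True l by (simp add: zero_ereal_def)
  next
    case False
    then show ?thesis
      using opt_welfare_le l by (simp add: ereal_divide_le_pos mult.commute)
  qed
qed

end

theorem theorem4p2:
  shows "price_of_anarchy {I. auction_instance I \<and> subadditive_valuations I} \<le> 3 \<and>
    (\<forall>I A. auction_instance I \<and> subadditive_valuations I \<and> coarse_correlated_eq I A \<longrightarrow>
       opt_welfare I \<le> 3 * liquid_welfare I A)"
proof -
  have *: "auction_equilibrium I A"
    if "auction_instance I" "subadditive_valuations I" "coarse_correlated_eq I A" for I A
    using that by unfold_locales
  show ?thesis
    unfolding price_of_anarchy_def
    using auction_equilibrium.opt_ratio_le[OF *] auction_equilibrium.opt_welfare_le[OF *]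
    by (auto intro!: SUP_least)
qed

end
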